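(* Let $A\in\mathbb{R}^{n\times n}$ be nonsingular with $\|A^{-1}\|_1<1/2$ and let $b\in\mathbb{R}^n$. Then any algorithm within the sign-flip framework (that is, for any initial sign vector and any rule selecting the nonempty subset $S\subseteq\mathcal{V}_z$ at each iteration) terminates after finitely many iterations at a sign vector $z^*$ that is a global maximizer over $\{-1,1\}^n$ of $F(z)=z^T(A-\operatorname{Diag}(z))^{-1}b$.
   Context: $\|\cdot\|_1$ for matrices is the maximum absolute column sum. For $z\in\{-1,1\}^n$ write $Z=\operatorname{Diag}(z)$. Under the stated condition $A-Z$ is nonsingular for every $z\in\{-1,1\}^n$. Sign-flip framework for the absolute value equation $Ax-|x|=b$: initialize $z\in\{-1,1\}^n$; compute $x=(A-Z)^{-1}b$ and the mismatch set $\mathcal{V}_z=\{i\in[n]: z_ix_i<0\}$, where $[n]=\{1,\dots,n\}$. While $\mathcal{V}_z\neq\emptyset$: select a nonempty subset $S\subseteq\mathcal{V}_z$ by some rule; replace $z_i$ by $-z_i$ for $i\in S$ (leaving the other components unchanged); recompute $Z$, $x=(A-Z)^{-1}b$ and $\mathcal{V}_z$. When $\mathcal{V}_z=\emptyset$, return $x$. One pass through the while loop is one iteration. *)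

theory Defs
  imports "HOL-Analysis.Analysis"
begin

text \<open>Maximum absolute column sum: \<open>j\<close> ranges over columns, \<open>i\<close> over rows.\<close>
definition matrix_norm1 :: "real ^ 'n ^ 'm \<Rightarrow> real" where
  "matrix_norm1 A = (MAX j. \<Sum>i\<in>UNIV. \<bar>A $ i $ j\<bar>)"

definition Diag :: "real ^ 'n \<Rightarrow> real ^ 'n ^ 'n" where
  "Diag z = (\<chi> i j. if i = j then z $ i else 0)"

definition sign_vectors :: "(real ^ 'n) set" where
  "sign_vectors = {z. \<forall>i. z $ i \<in> {-1, 1}}"

text \<open>The iterate \<open>x = (A - Diag z)\<inverse> b\<close>. As \<^const>\<open>matrix_inv\<close> is unspecified on singular
  matrices, this is meaningful only when \<open>A - Diag z\<close> is nonsingular.\<close>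
definition sf_point :: "real ^ 'n ^ 'n \<Rightarrow> real ^ 'n \<Rightarrow> real ^ 'n \<Rightarrow> real ^ 'n" where
  "sf_point A b z = matrix_inv (A - Diag z) *v b"

definition mismatch :: "real ^ 'n ^ 'n \<Rightarrow> real ^ 'n \<Rightarrow> real ^ 'n \<Rightarrow> 'n set" where
  "mismatch A b z = {i. z $ i * sf_point A b z $ i < 0}"

definition flip :: "'n set \<Rightarrow> real ^ 'n \<Rightarrow> real ^ 'n" where
  "flip S z = (\<chi> i. if i \<in> S then - (z $ i) else z $ i)"

text \<open>\<open>z k\<close> is the sign vector after \<open>k\<close> iterations and \<open>S k\<close> the set flipped in the next one.
  The loop stops at the first \<open>k\<close> with empty mismatch set; sequence entries beyond that are
  padding and play no role. Since \<open>S\<close> is an arbitrary sequence, the selection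
  rule may depend on the whole history, on \<open>k\<close>, or on chance.\<close>
definition sign_flip_execution ::
    "real ^ 'n ^ 'n \<Rightarrow> real ^ 'n \<Rightarrow> (nat \<Rightarrow> real ^ 'n) \<Rightarrow> (nat \<Rightarrow> 'n set) \<Rightarrow> bool" where
  "sign_flip_execution A b z S \<longleftrightarrow>
     z 0 \<in> sign_vectors \<and>
     (\<forall>k. (\<forall>j\<le>k. mismatch A b (z j) \<noteq> {}) \<longrightarrow>
        S k \<noteq> {} \<and> S k \<subseteq> mismatch A b (z k) \<and> z (Suc k) = flip (S k) (z k))"

definition terminates_after ::
    "real ^ 'n ^ 'n \<Rightarrow> real ^ 'n \<Rightarrow> (nat \<Rightarrow> real ^ 'n) \<Rightarrow> nat \<Rightarrow> bool" where
  "terminates_after A b z K \<longleftrightarrow>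
     mismatch A b (z K) = {} \<and> (\<forall>k<K. mismatch A b (z k) \<noteq> {})"

definition sf_objective :: "real ^ 'n ^ 'n \<Rightarrow> real ^ 'n \<Rightarrow> real ^ 'n \<Rightarrow> real" where
  "sf_objective A b z = z \<bullet> (matrix_inv (A - Diag z) *v b)"

end

theory Submission imports Defs begin

text \<open>Let \<open>q = \<parallel>A\<inverse>\<parallel>\<^sub>1 < 1/2\<close>. If \<open>x\<close>, \<open>x'\<close> are the iterates of two sign vectors \<open>z\<close>, \<open>z'\<close>, then
  \<open>w = A (x' - x)\<close> satisfies \<open>w = v + Z' A\<inverse> w\<close> with \<open>v = (Z' - Z) x\<close>, and since
  \<open>Z x = A x - b\<close> the coordinates of \<open>w\<close> sum to \<open>F z' - F z\<close>. As
  \<open>\<parallel>w - v\<parallel>\<^sub>1 \<le> q \<parallel>w\<parallel>\<^sub>1 \<le> (q / (1 - q)) \<parallel>v\<parallel>\<^sub>1\<close> with \<open>q / (1 - q) < 1\<close>, the sign of \<open>v\<close> decides the sign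
  of that sum. Flipping mismatched entries makes \<open>v \<ge> 0\<close> and \<open>v \<noteq> 0\<close>, so \<open>F\<close> strictly increases
  along an execution, which must stop. If \<open>z\<close> has no mismatch, then \<open>v \<le> 0\<close> for every \<open>z'\<close>,
  so \<open>z\<close> is a global maximizer.\<close>

text \<open>Exchanging the order of summation makes the absolute column sums the coefficients of
  \<open>\<bar>w $ j\<bar>\<close>, which is why the column norm fits the l1 norm of
  vectors.\<close>

lemma sum_abs_mult_vec_le:
  fixes B :: "real ^ 'n ^ 'm" and w :: "real ^ 'n"
  shows "(\<Sum>i\<in>UNIV. \<bar>(B *v w) $ i\<bar>) \<le> matrix_norm1 B * (\<Sum>j\<in>UNIV. \<bar>w $ j\<bar>)"
proof -
  have col: "(\<Sum>i\<in>UNIV. \<bar>B $ i $ j\<bar>) \<le> matrix_norm1 B" for j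
    unfolding matrix_norm1_def by (rule Max_ge) auto
  have "(\<Sum>i\<in>UNIV. \<bar>(B *v w) $ i\<bar>) \<le> (\<Sum>i\<in>UNIV. \<Sum>j\<in>UNIV. \<bar>B $ i $ j\<bar> * \<bar>w $ j\<bar>)"
    by (intro sum_mono) (auto simp: matrix_vector_mult_def abs_mult intro: order_trans[OF sum_abs])
  also have "\<dots> = (\<Sum>j\<in>UNIV. (\<Sum>i\<in>UNIV. \<bar>B $ i $ j\<bar>) * \<bar>w $ j\<bar>)"
    by (subst sum.swap) (simp add: sum_distrib_right)
  also have "\<dots> \<le> (\<Sum>j\<in>UNIV. matrix_norm1 B * \<bar>w $ j\<bar>)"
    by (intro sum_mono mult_right_mono col) auto
  finally show ?thesis by (simp add: sum_distrib_left)
qed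

lemma Diag_mult_vec: "(Diag z *v x) $ i = z $ i * x $ i"
  by (simp add: Diag_def matrix_vector_mult_def if_distrib[of "\<lambda>c. c * _"] cong: if_cong)

lemma finite_sign_vectors: "finite (sign_vectors :: (real ^ 'n) set)"
proof (rule finite_subset)
  show "(sign_vectors :: (real ^ 'n) set) \<subseteq> range (\<lambda>T. \<chi> i. if i \<in> T then 1 else - 1)"
  proof
    fix z :: "real ^ 'n"
    assume "z \<in> sign_vectors"
    then have "z = (\<chi> i. if i \<in> {i. z $ i = 1} then 1 else - 1)"
      by (auto simp: sign_vectors_def vec_eq_iff)
    then show "z \<in> range (\<lambda>T. \<chi> i. if i \<in> T then 1 else - 1)" by blast
  qed
qed simp

lemma flip_sign_vectors: "z \<in> sign_vectors \<Longrightarrow> flip S z \<in> sign_vectors"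
  unfolding sign_vectors_def flip_def by (auto; metis minus_minus)

lemma sign_abs: "z \<in> sign_vectors \<Longrightarrow> \<bar>z $ i\<bar> = 1"
  unfolding sign_vectors_def by (simp, metis abs_1 abs_minus_cancel)

lemma matrix_inv_mult_vec:
  fixes A :: "real ^ 'n ^ 'n"
  assumes "invertible A"
  shows "matrix_inv A *v (A *v x) = x" "A *v (matrix_inv A *v x) = x"
proof -
  have "A ** matrix_inv A = mat 1 \<and> matrix_inv A ** A = mat 1"
    using assms unfolding invertible_def matrix_inv_def by (rule someI_ex)
  then show "matrix_inv A *v (A *v x) = x" "A *v (matrix_inv A *v x) = x"
    by (simp_all add: matrix_vector_mul_assoc)
qed

locale ave_small_inverse =
  fixes A :: "real ^ 'n ^ 'n"
  assumes invertible_A: "invertible A"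
    and norm_inv: "matrix_norm1 (matrix_inv A) < 1 / 2"
begin

text \<open>The vector \<open>A *v d - v\<close> is \<open>Diag z *v d\<close>, whose entries have
  the same absolute values as those of \<open>d = matrix_inv A *v (A *v d)\<close>. Leaving
  \<open>v\<close> arbitrary serves both nonsingularity (\<open>v = 0\<close>) and the comparison of
  two iterates.\<close>

lemma perturbation_bounds:
  assumes z: "z \<in> sign_vectors"
    and v: "A *v d - Diag z *v d = v"
  shows "2 * (\<Sum>i\<in>UNIV. \<bar>(A *v d) $ i - v $ i\<bar>) \<le> (\<Sum>i\<in>UNIV. \<bar>(A *v d) $ i\<bar>)"
    and "A *v d \<noteq> 0 \<Longrightarrow> 2 * (\<Sum>i\<in>UNIV. \<bar>(A *v d) $ i - v $ i\<bar>) < (\<Sum>i\<in>UNIV. \<bar>(A *v d) $ i\<bar>)"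
proof -
  let ?w = "A *v d"
  have "?w $ i - v $ i = z $ i * d $ i" for i
    using v by (auto simp: Diag_mult_vec)
  then have "(\<Sum>i\<in>UNIV. \<bar>?w $ i - v $ i\<bar>) = (\<Sum>i\<in>UNIV. \<bar>(matrix_inv A *v ?w) $ i\<bar>)"
    using z by (simp add: abs_mult sign_abs matrix_inv_mult_vec[OF invertible_A])
  then have le: "(\<Sum>i\<in>UNIV. \<bar>?w $ i - v $ i\<bar>) \<le>
      matrix_norm1 (matrix_inv A) * (\<Sum>i\<in>UNIV. \<bar>?w $ i\<bar>)"
    using sum_abs_mult_vec_le[of "matrix_inv A" ?w] by simp
  have nonneg: "0 \<le> (\<Sum>i\<in>UNIV. \<bar>?w $ i\<bar>)" by (simp add: sum_nonneg)
  show "2 * (\<Sum>i\<in>UNIV. \<bar>?w $ i - v $ i\<bar>) \<le> (\<Sum>i\<in>UNIV. \<bar>?w $ i\<bar>)"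
    using le mult_right_mono[OF less_imp_le[OF norm_inv] nonneg] by simp
  assume "?w \<noteq> 0"
  then have "(\<Sum>i\<in>UNIV. \<bar>?w $ i\<bar>) \<noteq> 0"
    by (simp add: sum_nonneg_eq_0_iff vec_eq_iff)
  with nonneg have pos: "0 < (\<Sum>i\<in>UNIV. \<bar>?w $ i\<bar>)" by linarith
  show "2 * (\<Sum>i\<in>UNIV. \<bar>?w $ i - v $ i\<bar>) < (\<Sum>i\<in>UNIV. \<bar>?w $ i\<bar>)"
    using le mult_strict_right_mono[OF norm_inv pos] by linarith
qed

lemma invertible_diff_Diag:
  assumes z: "z \<in> sign_vectors"
  shows "invertible (A - Diag z)"
proof -
  have "d = 0" if "(A - Diag z) *v d = 0" for d
  proof -
    have v: "A *v d - Diag z *v d = 0"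
      using that by (simp add: matrix_vector_mult_diff_rdistrib)
    have "0 \<le> (\<Sum>i\<in>UNIV. \<bar>(A *v d) $ i\<bar>)" by (simp add: sum_nonneg)
    \<comment> \<open>Otherwise the strict bound with \<open>v = 0\<close> would make twice a
      nonnegative sum smaller than the sum itself.\<close>
    then have "A *v d = 0"
      using perturbation_bounds(2)[OF z v] unfolding zero_index diff_zero by linarith
    then show "d = 0"
      using matrix_inv_mult_vec(1)[OF invertible_A, of d] by simp
  qed
  then show ?thesis
    using invertible_left_inverse matrix_left_invertible_ker by blast
qed

text \<open>Write \<open>w = A *v d\<close> and \<open>e\<close> for the l1 norm of
  \<open>w - v\<close>. The sum of \<open>v\<close> is at most the sum of \<open>w\<close> plus
  \<open>e\<close>, and \<open>v \<ge> 0\<close> bounds the l1 norm of \<open>w\<close> by the sum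
  of \<open>v\<close> plus \<open>e\<close>. Hence the sum of \<open>w\<close> is at least its l1
  norm minus \<open>2 * e\<close>.\<close>

lemma perturbation_sum_pos:
  assumes z: "z \<in> sign_vectors"
    and v: "A *v d - Diag z *v d = v"
    and nonneg: "\<And>i. 0 \<le> v $ i"
  shows "0 \<le> (\<Sum>i\<in>UNIV. (A *v d) $ i)"
    and "v \<noteq> 0 \<Longrightarrow> 0 < (\<Sum>i\<in>UNIV. (A *v d) $ i)"
proof -
  let ?w = "A *v d"
  let ?e = "\<Sum>i\<in>UNIV. \<bar>?w $ i - v $ i\<bar>"
  have "(\<Sum>i\<in>UNIV. v $ i) - (\<Sum>i\<in>UNIV. ?w $ i) \<le> ?e"
    unfolding sum_subtractf[symmetric] by (intro sum_mono) simp
  moreover have "(\<Sum>i\<in>UNIV. \<bar>?w $ i\<bar>) \<le> (\<Sum>i\<in>UNIV. v $ i) + ?e"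
    unfolding sum.distrib[symmetric]
  proof (intro sum_mono)
    fix i show "\<bar>?w $ i\<bar> \<le> v $ i + \<bar>?w $ i - v $ i\<bar>" using nonneg[of i] by linarith
  qed
  ultimately have key: "(\<Sum>i\<in>UNIV. \<bar>?w $ i\<bar>) - 2 * ?e \<le> (\<Sum>i\<in>UNIV. ?w $ i)" by linarith
  show "0 \<le> (\<Sum>i\<in>UNIV. ?w $ i)"
    using key perturbation_bounds(1)[OF z v] by linarith
  assume "v \<noteq> 0"
  with v have "d \<noteq> 0" by auto
  then have "?w \<noteq> 0"
    using matrix_inv_mult_vec(1)[OF invertible_A, of d] by auto
  then show "0 < (\<Sum>i\<in>UNIV. ?w $ i)"
    using key perturbation_bounds(2)[OF z v] by linarith
qed

lemma sf_point_solves: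
  assumes "z \<in> sign_vectors"
  shows "A *v sf_point A b z - Diag z *v sf_point A b z = b"
  unfolding sf_point_def matrix_vector_mult_diff_rdistrib[symmetric]
  by (rule matrix_inv_mult_vec(2)[OF invertible_diff_Diag[OF assms]])

lemma sf_objective_diff:
  assumes "z \<in> sign_vectors" "z' \<in> sign_vectors"
  shows "sf_objective A b z' - sf_objective A b z =
    (\<Sum>i\<in>UNIV. (A *v (sf_point A b z' - sf_point A b z)) $ i)"
proof -
  have obj: "sf_objective A b u = (\<Sum>i\<in>UNIV. (A *v sf_point A b u) $ i - b $ i)"
    if "u \<in> sign_vectors" for u
  proof -
    have "u $ i * sf_point A b u $ i = (A *v sf_point A b u) $ i - b $ i" for i
      using arg_cong[OF sf_point_solves[OF that, of b], of "\<lambda>x. x $ i"]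
      by (simp add: Diag_mult_vec)
    then show ?thesis
      by (simp add: sf_objective_def inner_vec_def flip: sf_point_def)
  qed
  show ?thesis
    by (simp add: obj assms matrix_vector_mult_diff_distrib sum_subtractf)
qed

text \<open>Subtract the two equations and split \<open>Z' x' - Z x\<close> as
  \<open>Z' (x' - x) + (Z' - Z) x\<close>.\<close>

lemma sf_point_diff:
  fixes b :: "real ^ 'n"
  assumes "z \<in> sign_vectors" "z' \<in> sign_vectors"
  defines "d \<equiv> sf_point A b z' - sf_point A b z"
  shows "A *v d - Diag z' *v d = (\<chi> i. (z' $ i - z $ i) * sf_point A b z $ i)"
proof -
  have "(A *v sf_point A b z) $ i = b $ i + z $ i * sf_point A b z $ i"
       "(A *v sf_point A b z') $ i = b $ i + z' $ i * sf_point A b z' $ i" for i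
    using arg_cong[OF sf_point_solves[OF assms(1), of b], of "\<lambda>x. x $ i"]
      arg_cong[OF sf_point_solves[OF assms(2), of b], of "\<lambda>x. x $ i"]
    by (simp_all add: Diag_mult_vec)
  then show ?thesis
    by (simp add: vec_eq_iff d_def matrix_vector_mult_diff_distrib Diag_mult_vec algebra_simps)
qed

lemma sf_objective_flip_less:
  assumes z: "z \<in> sign_vectors" and S: "S \<noteq> {}" "S \<subseteq> mismatch A b z"
  shows "sf_objective A b z < sf_objective A b (flip S z)"
proof -
  let ?v = "\<chi> i. (flip S z $ i - z $ i) * sf_point A b z $ i"
  note z' = flip_sign_vectors[OF z, of S]
  have v: "?v $ i = (if i \<in> S then - 2 * (z $ i * sf_point A b z $ i) else 0)" for i
    by (simp add: flip_def)
  have mism: "z $ i * sf_point A b z $ i < 0" if "i \<in> S" for i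
    using that S(2) by (auto simp: mismatch_def)
  have nonneg: "0 \<le> ?v $ i" for i
    unfolding v using mism[of i] by auto
  obtain i where "i \<in> S" using S(1) by blast
  then have "?v $ i \<noteq> 0" unfolding v using mism[of i] by fastforce
  then have "?v \<noteq> 0" by (metis zero_index)
  then show ?thesis
    using perturbation_sum_pos(2)[OF z' sf_point_diff[OF z z'] nonneg] sf_objective_diff[OF z z', of b]
    by simp
qed

lemma sf_objective_le_of_no_mismatch:
  assumes z: "z \<in> sign_vectors" and z': "z' \<in> sign_vectors" and "mismatch A b z = {}"
  shows "sf_objective A b z' \<le> sf_objective A b z"
proof -
  let ?d = "sf_point A b z' - sf_point A b z"
  let ?v = "\<chi> i. (z' $ i - z $ i) * sf_point A b z $ i"
  \<comment> \<open>Here \<open>?v\<close> is entrywise nonpositive, so the sum estimate is applied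
    to \<open>- ?d\<close>.\<close>
  have eq: "A *v (- ?d) - Diag z' *v (- ?d) = - ?v"
    unfolding linear_neg[OF matrix_vector_mul_linear] sf_point_diff[OF z z', of b, symmetric]
    by simp
  have "0 \<le> (- ?v) $ i" for i
  proof -
    have "z $ i * sf_point A b z $ i \<ge> 0"
      using assms(3) by (auto simp: mismatch_def not_less)
    \<comment> \<open>Of two numbers with equal modulus, the nonnegative one is the larger.\<close>
    moreover have "\<bar>z' $ i * sf_point A b z $ i\<bar> = \<bar>z $ i * sf_point A b z $ i\<bar>"
      by (simp add: abs_mult sign_abs z z')
    ultimately show ?thesis by (simp add: left_diff_distrib)
  qed
  from perturbation_sum_pos(1)[OF z' eq this] show ?thesis
    using sf_objective_diff[OF z z', of b] unfolding linear_neg[OF matrix_vector_mul_linear]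
    by (simp add: sum_negf)
qed

end

theorem theorem3p4:
  fixes A :: "real ^ 'n ^ 'n" and b :: "real ^ 'n"
    and z :: "nat \<Rightarrow> real ^ 'n" and S :: "nat \<Rightarrow> 'n set"
  assumes "invertible A"
    and "matrix_norm1 (matrix_inv A) < 1 / 2"
    and "sign_flip_execution A b z S"
  shows "\<exists>K. terminates_after A b z K \<and>
             is_arg_max (sf_objective A b) (\<lambda>w. w \<in> sign_vectors) (z K)"
proof -
  interpret ave_small_inverse A using assms by unfold_locales
  have step: "S k \<noteq> {} \<and> S k \<subseteq> mismatch A b (z k) \<and> z (Suc k) = flip (S k) (z k)"
    if "\<And>j. j \<le> k \<Longrightarrow> mismatch A b (z j) \<noteq> {}" for k
    using assms(3) that by (auto simp: sign_flip_execution_def)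
  \<comment> \<open>Entries after the first empty mismatch set are unconstrained, hence the
    condition on all earlier indices.\<close>
  have sign: "z k \<in> sign_vectors" if "\<And>j. j < k \<Longrightarrow> mismatch A b (z j) \<noteq> {}" for k
    using that
  proof (induction k)
    case 0
    then show ?case using assms(3) by (simp add: sign_flip_execution_def)
  next
    case (Suc k)
    then show ?case using step[of k] by (simp add: flip_sign_vectors)
  qed
  have "\<exists>k. mismatch A b (z k) = {}"
  proof (rule ccontr)
    assume run: "\<nexists>k. mismatch A b (z k) = {}"
    then have "sf_objective A b (z k) < sf_objective A b (z (Suc k))" for k
      using sf_objective_flip_less[OF sign] step[of k] by simp
    then have "strict_mono (\<lambda>k. sf_objective A b (z k))"
      by (simp add: strict_mono_Suc_iff)
    \<comment> \<open>Increasing objective values forbid a repeated sign vector, and there are only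
      finitely many.\<close>
    then have "inj z"
      by (metis (mono_tags, lifting) injI strict_mono_eq)
    moreover have "finite (range z)"
      using run sign by (auto intro: finite_subset[OF _ finite_sign_vectors])
    ultimately show False
      using finite_imageD infinite_UNIV_nat by blast
  qed
  \<comment> \<open>Minimality of \<open>K\<close> also ensures that \<open>z K\<close> is a genuine
    iterate and so a sign vector.\<close>
  then obtain K where K: "mismatch A b (z K) = {}" "\<And>k. k < K \<Longrightarrow> mismatch A b (z k) \<noteq> {}"
    using exists_least_iff[of "\<lambda>k. mismatch A b (z k) = {}"] by blast
  then have "z K \<in> sign_vectors" using sign by blast
  then have "is_arg_max (sf_objective A b) (\<lambda>w. w \<in> sign_vectors) (z K)"
    using sf_objective_le_of_no_mismatch K(1) by (force simp: is_arg_max_def not_less)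
  with K show ?thesis by (auto simp: terminates_after_def)
qed

end
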